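(* Let $f$ be a bi-measurable map with canonical coordinates on a metric space $X$. If $f$ admits a strictly positive, positively pointwise expansive measure $\mu$, then no point of $X$ is a sink for $f$.
   Context: Let $(X,d)$ be a metric space. A bi-measurable map is a measurable bijection with measurable inverse. A Borel measure $\mu$ is non-atomic if $\mu(\{x\})=0$ for every $x\in X$, and strictly positive if every non-empty open set has positive measure. For $\delta>0$, $\Phi_\delta(x)=\{y\in X:d(f^n(x),f^n(y))\le\delta\text{ for all integers }n\ge0\}$. A non-atomic Borel measure $\mu$ on $X$ is positively pointwise expansive for $f$ if for each $x\in X$ there is $\delta_x>0$ with $\mu(\Phi_{\delta_x}(x))=0$. For $\delta>0$ the local stable and unstable sets are $W^s(x,\delta)=\{y\in X:d(f^i(x),f^i(y))\le\delta\text{ for all }i\ge0\}$ and $W^u(x,\delta)=\{y\in X:d(f^i(x),f^i(y))\le\delta\text{ for all }i\le0\}$. A point $x$ is a sink for $f$ if $W^u(x,\delta)=\{x\}$ for some $\delta>0$. $f$ has canonical coordinates if for every $\epsilon>0$ there is $\delta>0$ such that $d(x,y)<\delta$ implies $W^s(x,\epsilon)\cap W^u(y,\epsilon)\ne\emptyset$. *)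

theory Defs
  imports "HOL-Analysis.Analysis"
begin

definition bimeasurable :: "('a::topological_space \<Rightarrow> 'a) \<Rightarrow> bool" where
  "bimeasurable f \<longleftrightarrow> bij f \<and> f \<in> borel \<rightarrow>\<^sub>M borel \<and> inv f \<in> borel \<rightarrow>\<^sub>M borel"

text \<open>Integer iterates; only meaningful at negative exponents when \<open>f\<close> is a bijection.\<close>

definition int_iterate :: "('a \<Rightarrow> 'a) \<Rightarrow> int \<Rightarrow> 'a \<Rightarrow> 'a" where
  "int_iterate f i = (if 0 \<le> i then f ^^ nat i else inv f ^^ nat (- i))"

definition borel_measure :: "'a::topological_space measure \<Rightarrow> bool" where
  "borel_measure \<mu> \<longleftrightarrow> sets \<mu> = sets borel"

definition non_atomic :: "'a measure \<Rightarrow> bool" where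
  "non_atomic \<mu> \<longleftrightarrow> (\<forall>x. emeasure \<mu> {x} = 0)"

definition strictly_positive :: "'a::topological_space measure \<Rightarrow> bool" where
  "strictly_positive \<mu> \<longleftrightarrow> (\<forall>U. open U \<and> U \<noteq> {} \<longrightarrow> emeasure \<mu> U > 0)"

definition Phi :: "('a::metric_space \<Rightarrow> 'a) \<Rightarrow> real \<Rightarrow> 'a \<Rightarrow> 'a set" where
  "Phi f \<delta> x = {y. \<forall>n::nat. dist ((f ^^ n) x) ((f ^^ n) y) \<le> \<delta>}"

text \<open>
  \<open>emeasure\<close> is 0 on non-measurable sets, but for Borel measurable \<open>f\<close> every \<open>Phi f \<delta> x\<close> is a
  countable intersection of preimages of closed balls, hence Borel.
\<close>

definition positively_pointwise_expansive ::
    "('a::metric_space \<Rightarrow> 'a) \<Rightarrow> 'a measure \<Rightarrow> bool" where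
  "positively_pointwise_expansive f \<mu> \<longleftrightarrow>
     borel_measure \<mu> \<and> non_atomic \<mu> \<and> (\<forall>x. \<exists>\<delta>>0. emeasure \<mu> (Phi f \<delta> x) = 0)"

definition local_stable :: "('a::metric_space \<Rightarrow> 'a) \<Rightarrow> 'a \<Rightarrow> real \<Rightarrow> 'a set" where
  "local_stable f x \<delta> = {y. \<forall>i\<ge>0. dist (int_iterate f i x) (int_iterate f i y) \<le> \<delta>}"

definition local_unstable :: "('a::metric_space \<Rightarrow> 'a) \<Rightarrow> 'a \<Rightarrow> real \<Rightarrow> 'a set" where
  "local_unstable f x \<delta> = {y. \<forall>i\<le>0. dist (int_iterate f i x) (int_iterate f i y) \<le> \<delta>}"

definition sink :: "('a::metric_space \<Rightarrow> 'a) \<Rightarrow> 'a \<Rightarrow> bool" where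
  "sink f x \<longleftrightarrow> (\<exists>\<delta>>0. local_unstable f x \<delta> = {x})"

definition canonical_coordinates :: "('a::metric_space \<Rightarrow> 'a) \<Rightarrow> bool" where
  "canonical_coordinates f \<longleftrightarrow>
     (\<forall>\<epsilon>>0. \<exists>\<delta>>0. \<forall>x y. dist x y < \<delta> \<longrightarrow>
        local_stable f x \<epsilon> \<inter> local_unstable f y \<epsilon> \<noteq> {})"

end

theory Submission
  imports Defs
begin

text \<open>
  Suppose \<open>x\<close> is a sink, and take \<open>\<epsilon>\<close> so small that the local unstable set of size \<open>\<epsilon>\<close> at \<open>x\<close>
  is \<open>{x}\<close>.  Canonical coordinates make the local stable set of any nearby point \<open>y\<close> meet that
  singleton, so \<open>x\<close> lies in the local stable set of \<open>y\<close>.  By symmetry of the metric, the forward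
  orbit of \<open>y\<close> stays within \<open>\<epsilon>\<close> of the forward orbit of \<open>x\<close>.  Thus \<open>x\<close> is forward stable:
  every dynamical ball \<open>Phi f e x\<close> with \<open>e > 0\<close> contains a genuine ball around \<open>x\<close>
  (lemma \<open>sink_ball_subset_Phi\<close>).  For a strictly positive measure all these
  dynamical balls have positive measure, which is what positive pointwise expansivity at \<open>x\<close>
  forbids.
\<close>

lemma Phi_mono: "\<epsilon> \<le> e \<Longrightarrow> Phi f \<epsilon> x \<subseteq> Phi f e x"
  by (auto simp: Phi_def intro: order_trans)

lemma local_unstable_mono: "\<epsilon> \<le> e \<Longrightarrow> local_unstable f x \<epsilon> \<subseteq> local_unstable f x e"
  by (auto simp: local_unstable_def intro: order_trans)

lemma local_stable_eq_Phi: "local_stable f x \<epsilon> = Phi f \<epsilon> x"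
  by (auto simp: local_stable_def Phi_def int_iterate_def) (metis nat_int of_nat_0_le_iff)

lemma Phi_commute: "y \<in> Phi f \<epsilon> x \<longleftrightarrow> x \<in> Phi f \<epsilon> y"
  by (simp add: Phi_def dist_commute)

text \<open>
  Measurability is what allows the measure of a dynamical ball to be bounded below by that of
  an open subset.  It holds because \<open>Phi f e x\<close> is a countable intersection of preimages of
  closed balls.
\<close>

lemma Phi_in_sets_borel:
  fixes f :: "'a::metric_space \<Rightarrow> 'a"
  assumes f [measurable]: "f \<in> borel \<rightarrow>\<^sub>M borel"
  shows "Phi f e x \<in> sets borel"
proof -
  have "(f ^^ n) -` cball ((f ^^ n) x) e \<in> sets borel" for n
    using measurable_sets[OF measurable_compose_n[OF f, of n], of "cball ((f ^^ n) x) e"]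
    by simp
  moreover have "Phi f e x = (\<Inter>n. (f ^^ n) -` cball ((f ^^ n) x) e)"
    by (auto simp: Phi_def)
  ultimately show ?thesis
    by auto
qed

text \<open>
  The unstable half of the local product structure degenerates to a point at a sink, so the
  stable half has to account for a whole neighbourhood.
\<close>

lemma sink_ball_subset_Phi:
  fixes f :: "'a::metric_space \<Rightarrow> 'a"
  assumes "canonical_coordinates f" and "sink f x" and "e > 0"
  obtains \<delta> where "\<delta> > 0" and "ball x \<delta> \<subseteq> Phi f e x"
proof -
  from \<open>sink f x\<close> obtain \<eta> where "\<eta> > 0" and sink: "local_unstable f x \<eta> = {x}"
    by (auto simp: sink_def)
  define \<epsilon> where "\<epsilon> = min \<eta> e"
  have "\<epsilon> > 0"
    using \<open>\<eta> > 0\<close> \<open>e > 0\<close> by (simp add: \<epsilon>_def)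
  with assms(1) obtain \<delta> where "\<delta> > 0"
    and meet: "\<And>y z. dist y z < \<delta> \<Longrightarrow> local_stable f y \<epsilon> \<inter> local_unstable f z \<epsilon> \<noteq> {}"
    unfolding canonical_coordinates_def by meson
  have unstable: "local_unstable f x \<epsilon> \<subseteq> {x}"
    using local_unstable_mono[of \<epsilon> \<eta> f x] sink by (simp add: \<epsilon>_def)
  have "ball x \<delta> \<subseteq> Phi f e x"
  proof
    fix y
    assume "y \<in> ball x \<delta>"
    then have "local_stable f y \<epsilon> \<inter> local_unstable f x \<epsilon> \<noteq> {}"
      by (intro meet) (simp add: dist_commute)
    with unstable have "x \<in> local_stable f y \<epsilon>"
      by auto
    then have "y \<in> Phi f \<epsilon> x"
      by (simp add: local_stable_eq_Phi Phi_commute)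
    then show "y \<in> Phi f e x"
      using Phi_mono[of \<epsilon> e f x] by (auto simp: \<epsilon>_def)
  qed
  with \<open>\<delta> > 0\<close> show thesis
    by (rule that)
qed

theorem theorem3p12:
  fixes f :: "'a::metric_space \<Rightarrow> 'a"
  assumes "bimeasurable f"
    and "canonical_coordinates f"
    and "\<exists>\<mu>. strictly_positive \<mu> \<and> positively_pointwise_expansive f \<mu>"
  shows "\<not> (\<exists>x. sink f x)"
proof
  assume "\<exists>x. sink f x"
  then obtain x where "sink f x" ..
  from assms(3) obtain \<mu> where pos: "strictly_positive \<mu>"
    and expansive: "positively_pointwise_expansive f \<mu>"
    by blast
  from expansive obtain e where "e > 0" and null: "emeasure \<mu> (Phi f e x) = 0"
    by (auto simp: positively_pointwise_expansive_def)
  obtain \<delta> where "\<delta> > 0" and sub: "ball x \<delta> \<subseteq> Phi f e x"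
    using sink_ball_subset_Phi[OF assms(2) \<open>sink f x\<close> \<open>e > 0\<close>] .
  have "sets \<mu> = sets borel"
    using expansive by (simp add: positively_pointwise_expansive_def borel_measure_def)
  then have "Phi f e x \<in> sets \<mu>"
    using assms(1) Phi_in_sets_borel by (auto simp: bimeasurable_def)
  with sub have "emeasure \<mu> (ball x \<delta>) \<le> emeasure \<mu> (Phi f e x)"
    by (rule emeasure_mono)
  moreover have "emeasure \<mu> (ball x \<delta>) > 0"
    using pos \<open>\<delta> > 0\<close> by (simp add: strictly_positive_def)
  ultimately show False
    using null by simp
qed

end
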